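(* For each integer $k\ge 3$, asymptotically almost surely (i.e., with probability tending to $1$ as $n\to\infty$), $$t(W_k(n))\ge \frac{1.64k}{k+1}\cdot\frac{n}{k}.$$
   Context: A word $w=w_1\cdots w_n$ over a finite alphabet contains twins of length $t$ if there exist disjoint index sets $\{i_1<\cdots<i_t\}$ and $\{j_1<\cdots<j_t\}$ with $w_{i_1}\cdots w_{i_t}=w_{j_1}\cdots w_{j_t}$; $t(w)$ is the maximum length of twins in $w$. $W_k(n)$ is a word chosen uniformly at random among all $k^n$ words of length $n$ over a $k$-letter alphabet. *)

theory Defs
  imports "HOL-Probability.Probability"
begin

text \<open>
  Positions of a word are the list indices 0, ..., length w - 1, and \<^term>\<open>nths w I\<close> is the
  subsequence of w at the positions in I, read in increasing order. The inclusion of the index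
  sets in the set of positions is needed because \<^term>\<open>nths\<close> ignores indices out of range.
\<close>

definition has_twins :: "'a list \<Rightarrow> nat \<Rightarrow> bool" where
  "has_twins w t \<longleftrightarrow>
     (\<exists>I J. I \<subseteq> {..<length w} \<and> J \<subseteq> {..<length w} \<and> I \<inter> J = {} \<and>
            card I = t \<and> card J = t \<and> nths w I = nths w J)"

text \<open>The maximum exists: the empty index sets give twins of length 0, and 2 t is at most length w.\<close>

definition max_twins :: "'a list \<Rightarrow> nat" where
  "max_twins w = Max {t. has_twins w t}"

definition words :: "'a set \<Rightarrow> nat \<Rightarrow> 'a list set" where
  "words A n = {w. set w \<subseteq> A \<and> length w = n}"

definition random_word :: "'a set \<Rightarrow> nat \<Rightarrow> 'a list pmf" where
  "random_word A n = pmf_of_set (words A n)"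

lemma finite_twin_lengths: "finite {t. has_twins w t}"
proof (rule finite_subset)
  show "{t. has_twins w t} \<subseteq> {..length w}"
    unfolding has_twins_def using card_mono[OF finite_lessThan, of _ "length w"] by force
qed simp

lemma has_twins_0: "has_twins w 0"
  unfolding has_twins_def by (intro exI[of _ "{}"]) simp

lemma has_twins_max_twins: "has_twins w (max_twins w)"
  using Max_in[OF finite_twin_lengths, of w] has_twins_0[of w] unfolding max_twins_def by blast

lemma max_twins_ge: "has_twins w t \<Longrightarrow> t \<le> max_twins w"
  unfolding max_twins_def by (simp add: finite_twin_lengths)

lemma finite_words: "finite A \<Longrightarrow> finite (words A n)"
  unfolding words_def by (rule finite_lists_length_eq)

lemma card_words: "finite A \<Longrightarrow> card (words A n) = card A ^ n"
  unfolding words_def by (rule card_lists_length_eq)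

lemma words_nonempty: "A \<noteq> {} \<Longrightarrow> words A n \<noteq> {}"
proof -
  assume "A \<noteq> {}"
  then obtain a where "a \<in> A" by blast
  then have "replicate n a \<in> words A n" unfolding words_def by auto
  then show ?thesis by blast
qed

end

theory Submission imports Defs "HOL-Library.Sublist" begin

text \<open>
  Read the word from left to right and assign letters to the two twins online. The first twin runs
  ahead of the second one by a queue of letters still to be matched. A new letter is either put
  at the end of the queue or, if it occurs in the queue, appended to the second twin, which removes
  the letters up to its first occurrence from the queue; any letter may be dropped from the queue at
  any time. It suffices to use queues of the forms \<open>[]\<close>, \<open>a\<close>, \<open>aa\<close>, \<open>ab\<close>, \<open>abc\<close>, \<open>abcc\<close>. With a
  suitable potential on these six states, each letter increases the sum of matches and potential by
  at least 1.641 / (k + 1) on average, whatever the current queue. An exponential moment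
  estimate turns this drift into a lower bound that holds with probability tending to 1.
\<close>

text \<open>The function \<open>f\<close> returns the gain and the next state. States stay abstract
  because the concentration estimate needs only a potential on them; for twins they are
  queues.\<close>

fun matches :: "('s \<Rightarrow> 'a \<Rightarrow> nat \<times> 's) \<Rightarrow> 's \<Rightarrow> 'a list \<Rightarrow> nat" where
  "matches f x [] = 0"
| "matches f x (c # w) = fst (f x c) + matches f (snd (f x c)) w"

section \<open>From queues to twins\<close>

lemma has_twins_labelled:
  assumes "map fst (filter (\<lambda>p. snd p = Some True) l) = map fst (filter (\<lambda>p. snd p = Some False) l)"
  shows "has_twins (map fst l) (length (filter (\<lambda>p. snd p = Some False) l))"
proof -
  define P where "P b = {i. i < length l \<and> snd (l ! i) = Some b}" for b
  have nths_P: "nths (map fst l) (P b) = map fst (filter (\<lambda>p. snd p = Some b) l)" for b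
    unfolding P_def by (simp add: nths_map filter_eq_nths)
  have card_P: "card (P b) = length (filter (\<lambda>p. snd p = Some b) l)" for b
    unfolding P_def by (simp add: length_filter_conv_card)
  have "length (filter (\<lambda>p. snd p = Some True) l) = length (filter (\<lambda>p. snd p = Some False) l)"
    using arg_cong[OF assms, of length] by simp
  moreover have "P b \<subseteq> {..<length l}" "P True \<inter> P False = {}" for b
    by (auto simp: P_def)
  ultimately show ?thesis
    unfolding has_twins_def using assms
    by (intro exI[of _ "P True"] exI[of _ "P False"]) (simp add: nths_P card_P)
qed

text \<open>Using \<open>subseq\<close> instead of equality lets any move drop queued letters; in
  the second disjunct this includes the letters in front of the matched \<open>c\<close>.\<close>

definition legal_move :: "'a list \<Rightarrow> 'a \<Rightarrow> nat \<times> 'a list \<Rightarrow> bool" where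
  "legal_move x c m \<longleftrightarrow>
     fst m = 0 \<and> subseq (snd m) (x @ [c]) \<or> fst m = 1 \<and> subseq (c # snd m) x"

text \<open>The induction decides labels in hindsight: \<open>z\<close> consists of the letters of
  the queue \<open>x\<close> that the second twin uses later. Letters that are dropped or remain
  queued at the end stay unlabelled.\<close>

lemma matches_labelling:
  assumes legal: "\<And>x c. x \<in> S \<Longrightarrow> c \<in> A \<Longrightarrow> legal_move x c (f x c) \<and> snd (f x c) \<in> S"
    and "x \<in> S" "set w \<subseteq> A"
  shows "\<exists>z l. subseq z x \<and> map fst l = w \<and>
           z @ map fst (filter (\<lambda>p. snd p = Some True) l) = map fst (filter (\<lambda>p. snd p = Some False) l) \<and>
           length (filter (\<lambda>p. snd p = Some False) l) = matches f x w"
  using assms(2,3)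
proof (induction w arbitrary: x)
  case Nil
  then show ?case by (intro exI[of _ "[]"]) simp
next
  case (Cons c w)
  let ?T = "\<lambda>l. map fst (filter (\<lambda>p. snd p = Some True) l)"
  let ?F = "\<lambda>l. map fst (filter (\<lambda>p. snd p = Some False) l)"
  have *: "legal_move x c (f x c)" "snd (f x c) \<in> S"
    using legal[of x c] Cons.prems by auto
  obtain z l where zl: "subseq z (snd (f x c))" "map fst l = w" "z @ ?T l = ?F l"
      "length (filter (\<lambda>p. snd p = Some False) l) = matches f (snd (f x c)) w"
    using Cons.IH[OF *(2)] Cons.prems by auto
  consider "fst (f x c) = 0" "subseq z (x @ [c])" | "fst (f x c) = 1" "subseq (c # z) x"
    using *(1) zl(1) unfolding legal_move_def
    by (meson subseq_Cons2_iff subseq_order.trans)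
  then show ?case
  proof cases
    case 1
    obtain y e where ye: "z = y @ e" "subseq y x" "subseq e [c]"
      using 1(2) by (meson subseq_append_iff)
    \<comment> \<open>If \<open>c\<close> is used later, it joins the first twin; otherwise it gets
      the label \<open>None\<close>.\<close>
    consider "e = []" | "e = [c]"
      using ye(3) by (cases e) (auto dest: list_emb_Nil2 split: if_splits)
    then show ?thesis
    proof cases
      case 1
      then show ?thesis
        using ye zl \<open>fst (f x c) = 0\<close> by (intro exI[of _ y] exI[of _ "(c, None) # l"]) simp
    next
      case 2
      then show ?thesis
        using ye zl \<open>fst (f x c) = 0\<close> by (intro exI[of _ y] exI[of _ "(c, Some True) # l"]) simp
    qed
  next
    case 2
    then show ?thesis
      using zl by (intro exI[of _ "c # z"] exI[of _ "(c, Some False) # l"]) simp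
  qed
qed

lemma matches_le_max_twins:
  assumes "\<And>x c. x \<in> S \<Longrightarrow> c \<in> A \<Longrightarrow> legal_move x c (f x c) \<and> snd (f x c) \<in> S"
    and "[] \<in> S" "set w \<subseteq> A"
  shows "matches f [] w \<le> max_twins w"
proof -
  obtain z l where "subseq z []" "map fst l = w"
    "z @ map fst (filter (\<lambda>p. snd p = Some True) l) = map fst (filter (\<lambda>p. snd p = Some False) l)"
    "length (filter (\<lambda>p. snd p = Some False) l) = matches f [] w"
    using matches_labelling[OF assms] by blast
  then show ?thesis
    using has_twins_labelled[of l] max_twins_ge[of w] by (cases z) auto
qed

section \<open>Concentration from drift\<close>

text \<open>For negative \<open>x\<close>, multiplying by \<open>exp y\<close> with
  \<open>y = - x\<close> reduces the claim to the quadratic Taylor lower bound of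
  \<open>exp y\<close>.\<close>

lemma exp_le_quadratic:
  fixes x :: real
  assumes "\<bar>x\<bar> \<le> 1"
  shows "exp x \<le> 1 + x + x\<^sup>2"
proof (cases "x \<ge> 0")
  case True
  then show ?thesis using assms exp_bound by simp
next
  case False
  define y where "y = - x"
  have y: "y \<ge> 0" using False by (simp add: y_def)
  have "1 \<le> (1 + y + y\<^sup>2 / 2) * (1 - y + y\<^sup>2)"
  proof -
    have "(1 + y + y\<^sup>2 / 2) * (1 - y + y\<^sup>2) = 1 + (y^2 + y^3 + y^4) / 2"
      by (simp add: field_simps power2_eq_square power3_eq_cube power4_eq_xxxx)
    then show ?thesis using y by simp
  qed
  also have "\<dots> \<le> exp y * (1 - y + y\<^sup>2)"
  proof (rule mult_right_mono)
    show "1 + y + y\<^sup>2 / 2 \<le> exp y" using exp_lower_Taylor_quadratic[OF y] .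
    have "0 \<le> (1 - y)\<^sup>2 + y" using y by simp
    then show "0 \<le> 1 - y + y\<^sup>2" by (simp add: power2_eq_square algebra_simps)
  qed
  finally have "exp (- y) \<le> 1 - y + y\<^sup>2"
    by (simp add: exp_minus field_simps)
  then show ?thesis by (simp add: y_def)
qed

lemma sum_words_Suc:
  fixes h :: "'a list \<Rightarrow> real"
  shows "(\<Sum>w\<in>words A (Suc n). h w) = (\<Sum>c\<in>A. \<Sum>w\<in>words A n. h (c # w))"
proof -
  have eq: "words A (Suc n) = (\<lambda>(c, w). c # w) ` (A \<times> words A n)"
    unfolding words_def by (auto simp: length_Suc_conv image_iff)
  have "(\<Sum>w\<in>words A (Suc n). h w) = (\<Sum>(c, w)\<in>A \<times> words A n. h (c # w))"
    unfolding eq by (subst sum.reindex) (auto simp: inj_on_def case_prod_unfold)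
  then show ?thesis by (simp add: sum.cartesian_product)
qed

text \<open>Induction on the first letter: the potential telescopes up to its final value, at most
  \<open>B\<close>. By the drift, the centred increment \<open>u\<close> has nonnegative mean, so
  each letter costs a factor at most \<open>1 + (t * M)\<^sup>2\<close> beyond
  \<open>exp (- t * r)\<close>.\<close>

lemma matches_exp_moment:
  fixes \<phi> :: "'s \<Rightarrow> real" and r M B t :: real
  assumes A: "finite A" "A \<noteq> {}"
    and closed: "\<And>x c. x \<in> S \<Longrightarrow> c \<in> A \<Longrightarrow> snd (f x c) \<in> S"
    and bounded: "\<And>x. x \<in> S \<Longrightarrow> \<phi> x \<le> B"
    and increment: "\<And>x c. x \<in> S \<Longrightarrow> c \<in> A \<Longrightarrow> \<bar>real (fst (f x c)) + \<phi> (snd (f x c)) - \<phi> x - r\<bar> \<le> M"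
    and drift: "\<And>x. x \<in> S \<Longrightarrow> (\<Sum>c\<in>A. real (fst (f x c)) + \<phi> (snd (f x c))) \<ge> card A * (\<phi> x + r)"
    and t: "0 \<le> t" "t * M \<le> 1" and "x \<in> S"
  shows "(\<Sum>w\<in>words A n. exp (- t * matches f x w))
           \<le> card A ^ n * exp (t * (B - \<phi> x) - n * (t * r - (t * M)\<^sup>2))"
  using \<open>x \<in> S\<close>
proof (induction n arbitrary: x)
  case 0
  have "words A 0 = {[]}" by (auto simp: words_def)
  then show ?case using bounded[OF 0] t by simp
next
  case (Suc n)
  define u where "u c = real (fst (f x c)) + \<phi> (snd (f x c)) - \<phi> x - r" for c
  \<comment> \<open>Chosen so that the induction hypothesis bounds the contribution of the letter
    \<open>c\<close> by \<open>K * exp (- t * u c)\<close>.\<close>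
  define K where "K = card A ^ n * exp (t * (B - \<phi> x) - t * r - n * (t * r - (t * M)\<^sup>2))"
  have step: "exp (- t * u c) \<le> 1 - t * u c + (t * M)\<^sup>2" if "c \<in> A" for c
  proof -
    have "\<bar>u c\<bar> \<le> M" using increment[OF Suc.prems that] by (simp add: u_def)
    then have le: "\<bar>t * u c\<bar> \<le> t * M" using t by (simp add: abs_mult mult_left_mono)
    then have "(t * u c)\<^sup>2 \<le> (t * M)\<^sup>2" using power_mono[OF le, of 2] by simp
    moreover have "exp (- (t * u c)) \<le> 1 + - (t * u c) + (- (t * u c))\<^sup>2"
      using le t(2) by (intro exp_le_quadratic) simp
    ultimately show ?thesis by simp
  qed
  have "(\<Sum>w\<in>words A (Suc n). exp (- t * matches f x w))
      = (\<Sum>c\<in>A. exp (- t * fst (f x c)) * (\<Sum>w\<in>words A n. exp (- t * matches f (snd (f x c)) w)))"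
    by (simp add: sum_words_Suc sum_distrib_left exp_add[symmetric] algebra_simps)
  also have "\<dots> \<le> (\<Sum>c\<in>A. exp (- t * fst (f x c)) *
      (card A ^ n * exp (t * (B - \<phi> (snd (f x c))) - n * (t * r - (t * M)\<^sup>2))))"
    using Suc.IH[OF closed[OF Suc.prems]] by (intro sum_mono mult_left_mono) auto
  also have "\<dots> = (\<Sum>c\<in>A. K * exp (- t * u c))"
    unfolding K_def u_def by (intro sum.cong) (simp_all add: algebra_simps flip: exp_add)
  also have "\<dots> \<le> (\<Sum>c\<in>A. K * (1 - t * u c + (t * M)\<^sup>2))"
    using step by (intro sum_mono mult_left_mono) (auto simp: K_def)
  also have "\<dots> = K * (card A * (1 + (t * M)\<^sup>2) - t * (\<Sum>c\<in>A. u c))"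
    by (simp add: sum_distrib_left[symmetric] sum.distrib sum_subtractf algebra_simps)
  also have "\<dots> \<le> K * (card A * exp ((t * M)\<^sup>2))"
  proof (rule mult_left_mono)
    have "(\<Sum>c\<in>A. u c) \<ge> 0"
      using drift[OF Suc.prems] by (simp add: u_def sum.distrib sum_subtractf algebra_simps)
    moreover have "card A * (1 + (t * M)\<^sup>2) \<le> card A * exp ((t * M)\<^sup>2)"
      by (intro mult_left_mono exp_ge_add_one_self) simp
    ultimately show "card A * (1 + (t * M)\<^sup>2) - t * (\<Sum>c\<in>A. u c) \<le> card A * exp ((t * M)\<^sup>2)"
      using t(1) by (smt (verit) mult_nonneg_nonneg)
  qed (simp add: K_def)
  also have "\<dots> = card A ^ Suc n * exp (t * (B - \<phi> x) - Suc n * (t * r - (t * M)\<^sup>2))"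
    unfolding K_def by (simp add: algebra_simps flip: exp_add)
  finally show ?case .
qed

lemma matches_tendsto:
  fixes \<phi> :: "'s \<Rightarrow> real" and r M B \<rho> :: real
  assumes A: "finite A" "A \<noteq> {}"
    and closed: "\<And>x c. x \<in> S \<Longrightarrow> c \<in> A \<Longrightarrow> snd (f x c) \<in> S"
    and bounded: "\<And>x. x \<in> S \<Longrightarrow> \<phi> x \<le> B"
    and increment: "\<And>x c. x \<in> S \<Longrightarrow> c \<in> A \<Longrightarrow> \<bar>real (fst (f x c)) + \<phi> (snd (f x c)) - \<phi> x - r\<bar> \<le> M"
    and drift: "\<And>x. x \<in> S \<Longrightarrow> (\<Sum>c\<in>A. real (fst (f x c)) + \<phi> (snd (f x c))) \<ge> card A * (\<phi> x + r)"
    and "x \<in> S" "\<rho> < r"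
  shows "(\<lambda>n. measure_pmf.prob (random_word A n) {w. matches f x w \<ge> \<rho> * n}) \<longlonglongrightarrow> 1"
proof -
  \<comment> \<open>This \<open>t\<close> maximises the decay rate
    \<open>t * (r - \<rho>) - (t * M')\<^sup>2\<close>, with maximum \<open>\<delta>\<close>.
    Enlarging \<open>M\<close> to \<open>M'\<close> makes it positive and ensures
    \<open>t * M' \<le> 1\<close>.\<close>
  define M' where "M' = max M (max 1 (r - \<rho>))"
  define t where "t = (r - \<rho>) / (2 * M'\<^sup>2)"
  define \<delta> where "\<delta> = t * (r - \<rho>) / 2"
  have M': "M \<le> M'" "1 \<le> M'" "r - \<rho> \<le> M'" by (auto simp: M'_def)
  have t: "0 < t" "t * M' \<le> 1"
    using M' \<open>\<rho> < r\<close> mult_mono[of 1 M' 0 M']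
    by (auto simp: t_def power2_eq_square divide_le_eq)
  have \<delta>: "\<delta> > 0" "(t * M')\<^sup>2 = \<delta>"
    using t M' \<open>\<rho> < r\<close> by (simp_all add: \<delta>_def t_def power2_eq_square)
  have \<delta>': "t * (r - \<rho>) = 2 * \<delta>" by (simp add: \<delta>_def)
  have increment': "\<bar>real (fst (f x c)) + \<phi> (snd (f x c)) - \<phi> x - r\<bar> \<le> M'" if "x \<in> S" "c \<in> A" for x c
    using increment[OF that] M' by linarith
  define bad where "bad n = {w. \<not> matches f x w \<ge> \<rho> * n}" for n :: nat
  have bound: "measure_pmf.prob (random_word A n) (bad n) \<le> exp (t * (B - \<phi> x)) * exp (- \<delta>) ^ n" for n
  proof -
    have fin: "finite (words A n)" "words A n \<noteq> {}"
      using A by (auto simp: finite_words words_nonempty)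
    have pos: "real (card A ^ n) > 0" using A by (simp add: card_gt_0_iff)
    have "real (card (words A n \<inter> bad n)) = (\<Sum>w\<in>words A n \<inter> bad n. 1)" by simp
    \<comment> \<open>Markov's inequality: each summand is at least 1 on a bad word.\<close>
    also have "\<dots> \<le> (\<Sum>w\<in>words A n \<inter> bad n. exp (t * \<rho> * n) * exp (- t * matches f x w))"
      using t(1) by (intro sum_mono) (auto simp: bad_def mult.assoc simp flip: exp_add)
    also have "\<dots> \<le> (\<Sum>w\<in>words A n. exp (t * \<rho> * n) * exp (- t * matches f x w))"
      using fin by (intro sum_mono2) auto
    also have "\<dots> \<le> exp (t * \<rho> * n) *
        (card A ^ n * exp (t * (B - \<phi> x) - n * (t * r - (t * M')\<^sup>2)))"
      unfolding sum_distrib_left[symmetric]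
      using t by (intro mult_left_mono matches_exp_moment[OF A closed bounded increment' drift])
        (auto simp: \<open>x \<in> S\<close>)
    also have "\<dots> = card A ^ n * exp (t * (B - \<phi> x) - n * (t * (r - \<rho>) - (t * M')\<^sup>2))"
      by (simp add: algebra_simps flip: exp_add)
    also have "\<dots> = card A ^ n * (exp (t * (B - \<phi> x)) * exp (- \<delta>) ^ n)"
      unfolding \<delta>(2) \<delta>' by (simp flip: exp_add exp_of_nat_mult)
    finally show ?thesis
      using fin pos A unfolding random_word_def
      by (simp add: measure_pmf_of_set card_words field_simps)
  qed
  have "(\<lambda>n. exp (t * (B - \<phi> x)) * exp (- \<delta>) ^ n) \<longlonglongrightarrow> 0"
    using \<delta>(1) by (intro tendsto_mult_right_zero LIMSEQ_power_zero) simp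
  then have "(\<lambda>n. measure_pmf.prob (random_word A n) (bad n)) \<longlonglongrightarrow> 0"
    by (rule Lim_null_comparison[rotated]) (use bound in simp_all)
  then have "(\<lambda>n. 1 - measure_pmf.prob (random_word A n) (bad n)) \<longlonglongrightarrow> 1 - 0"
    by (intro tendsto_diff tendsto_const)
  moreover have "1 - measure_pmf.prob (random_word A n) (bad n)
      = measure_pmf.prob (random_word A n) {w. matches f x w \<ge> \<rho> * n}" for n
    using measure_pmf.prob_compl[of "bad n" "random_word A n"]
    by (simp add: bad_def Compl_eq_Diff_UNIV[symmetric] Collect_neg_eq[symmetric])
  ultimately show ?thesis by simp
qed

section \<open>A strategy with six queue shapes\<close>

text \<open>Drops keep the queue within the six shapes. From \<open>abc\<close> the letter
  \<open>c\<close> is queued, as matching it would lose \<open>a\<close> and \<open>b\<close>; from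
  \<open>abcc\<close>, matching \<open>a\<close> also drops one \<open>c\<close>. The last equation
  is meant for \<open>e = d\<close>.\<close>

fun step :: "'a list \<Rightarrow> 'a \<Rightarrow> nat \<times> 'a list" where
  "step [] c = (0, [c])"
| "step [a] c = (if c = a then (1, []) else (0, [a, c]))"
| "step [a, b] c =
     (if c = a then (1, [b]) else if a = b then (0, [b, c])
      else if c = b then (1, []) else (0, [a, b, c]))"
| "step [a, b, d] c =
     (if c = a then (1, [b, d]) else if c = b then (1, [d])
      else if c = d then (0, [a, b, d, d]) else (0, [a, b, d]))"
| "step (a # b # d # e # _) c =
     (if c = a then (1, [b, d]) else if c = b then (1, [d, d])
      else if c = d then (1, [d]) else (0, [a, b, d, d]))"

definition queues :: "'a set \<Rightarrow> 'a list set" where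
  "queues A = {x. set x \<subseteq> A \<and>
     (x = [] \<or> (\<exists>a. x = [a]) \<or> (\<exists>a. x = [a, a]) \<or> (\<exists>a b. x = [a, b] \<and> a \<noteq> b) \<or>
      (\<exists>a b c. x = [a, b, c] \<and> distinct [a, b, c]) \<or>
      (\<exists>a b c. x = [a, b, c, c] \<and> distinct [a, b, c]))}"

lemma queues_cases [consumes 1, case_names empty one double two three four]:
  assumes "x \<in> queues A"
  obtains "x = []"
    | a where "x = [a]" "a \<in> A"
    | a where "x = [a, a]" "a \<in> A"
    | a b where "x = [a, b]" "a \<noteq> b" "a \<in> A" "b \<in> A"
    | a b c where "x = [a, b, c]" "a \<noteq> b" "a \<noteq> c" "b \<noteq> c" "a \<in> A" "b \<in> A" "c \<in> A"
    | a b c where "x = [a, b, c, c]" "a \<noteq> b" "a \<noteq> c" "b \<noteq> c" "a \<in> A" "b \<in> A" "c \<in> A"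
  using assms unfolding queues_def by auto

lemma step_legal:
  assumes "x \<in> queues A" "c \<in> A"
  shows "legal_move x c (step x c) \<and> snd (step x c) \<in> queues A"
  using assms by (cases rule: queues_cases) (auto simp: legal_move_def queues_def)

text \<open>
  For k = 3 the drift inequalities below have a solution only up to about 1.6441 in place of 1.641.
  The weights are a rounded solution; they serve all larger k as well because the inequalities,
  multiplied by k + 1, are linear in k.
\<close>

fun weight :: "'a list \<Rightarrow> real" where
  "weight [] = 0"
| "weight [a] = 1"
| "weight [a, b] = (if a = b then 1.33 else 1.784)"
| "weight [a, b, c] = 2.48"
| "weight (a # b # c # d # _) = 2.8"

lemma weight_bounds: "0 \<le> weight x" "weight x \<le> 2.8"
  by (induction x rule: weight.induct) auto

text \<open>All letters absent from the queue have the same effect, so a sum over the alphabet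
  reduces to at most three special letters.\<close>

lemma sum_constant_outside:
  fixes h :: "'a \<Rightarrow> real"
  assumes "finite A" "T \<subseteq> A" "\<And>c. c \<in> A - T \<Longrightarrow> h c = v"
  shows "(\<Sum>c\<in>A. h c) = (\<Sum>c\<in>T. h c) + (real (card A) - card T) * v"
proof -
  have "finite T" using assms finite_subset by blast
  have "(\<Sum>c\<in>A. h c) = (\<Sum>c\<in>A - T. h c) + (\<Sum>c\<in>T. h c)"
    using assms by (intro sum.subset_diff)
  also have "(\<Sum>c\<in>A - T. h c) = (\<Sum>c\<in>A - T. v)"
    using assms by (intro sum.cong) auto
  also have "\<dots> = (real (card A) - card T) * v"
    using assms \<open>finite T\<close> card_mono[of A T] by (simp add: card_Diff_subset of_nat_diff)
  finally show ?thesis by simp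
qed

text \<open>Measuring the potential in units of \<open>r\<close> allows \<open>k\<close> to be
  eliminated through \<open>k * r = 1.641 - r\<close>. Each nonempty shape then leaves one linear
  inequality in \<open>r\<close>; the empty queue gives equality.\<close>

lemma step_drift:
  assumes A: "finite A" "card A \<ge> 3" and x: "x \<in> queues A"
    and r: "r = 1.641 / (real (card A) + 1)"
  shows "(\<Sum>c\<in>A. real (fst (step x c)) + r * weight (snd (step x c))) \<ge> card A * (r * weight x + r)"
proof -
  let ?h = "\<lambda>c. real (fst (step x c)) + r * weight (snd (step x c))"
  define k where "k = real (card A)"
  have k: "k \<ge> 3" using A by (simp add: k_def)
  \<comment> \<open>The bound 0.41025 is 1.641 / 4, the value of \<open>r\<close> at
    \<open>k = 3\<close>.\<close>
  have r: "k * r = 1.641 - r" "r > 0" "r \<le> 0.41025"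
    using k unfolding r k_def[symmetric] by (simp_all add: field_simps)
  have kr: "k * (r * y) = (1.641 - r) * y" for y
    using r(1) by (simp flip: mult.assoc)
  note outside = sum_constant_outside[OF A(1), of _ ?h, folded k_def]
  show ?thesis
    using x
  proof (cases rule: queues_cases)
    case empty
    then show ?thesis by simp
  next
    case (one a)
    have "sum ?h A = sum ?h {a} + (k - card {a}) * (r * 1.784)"
      using one by (intro outside) auto
    then show ?thesis
      using one r(2,3) by (simp add: k_def[symmetric] r(1) kr algebra_simps diff_divide_distrib add_divide_distrib)
  next
    case (double a)
    have "sum ?h A = sum ?h {a} + (k - card {a}) * (r * 1.784)"
      using double by (intro outside) auto
    then show ?thesis
      using double r(2,3) by (simp add: k_def[symmetric] r(1) kr algebra_simps diff_divide_distrib add_divide_distrib)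
  next
    case (two a b)
    have "sum ?h A = sum ?h {a, b} + (k - card {a, b}) * (r * 2.48)"
      using two by (intro outside) auto
    then show ?thesis
      using two r(2,3) by (simp add: k_def[symmetric] r(1) kr algebra_simps diff_divide_distrib add_divide_distrib)
  next
    case (three a b c)
    have "sum ?h A = sum ?h {a, b, c} + (k - card {a, b, c}) * (r * 2.48)"
      using three by (intro outside) auto
    then show ?thesis
      using three r(2,3) by (simp add: k_def[symmetric] r(1) kr algebra_simps diff_divide_distrib add_divide_distrib)
  next
    case (four a b c)
    have "sum ?h A = sum ?h {a, b, c} + (k - card {a, b, c}) * (r * 2.8)"
      using four by (intro outside) auto
    then show ?thesis
      using four r(2,3) by (simp add: k_def[symmetric] r(1) kr algebra_simps diff_divide_distrib add_divide_distrib)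
  qed
qed

theorem theorem1p2:
  fixes A :: "'a set" and k :: nat
  assumes "k \<ge> 3" and "finite A" and "card A = k"
  shows "(\<lambda>n::nat. measure_pmf.prob (random_word A n)
            {w. real (max_twins w) \<ge> (1.64 * real k / (real k + 1)) * (real n / real k)})
         \<longlonglongrightarrow> 1"
proof -
  define r where "r = 1.641 / (real (card A) + 1)"
  define \<rho> where "\<rho> = 1.64 / (real k + 1)"
  have r: "0 < r" "r \<le> 0.41025" using assms by (auto simp: r_def field_simps)
  have "A \<noteq> {}" using assms by auto
  \<comment> \<open>The gap between 1.64 and 1.641 provides the strict inequality that concentration
    requires.\<close>
  have "\<rho> < r" unfolding \<rho>_def r_def \<open>card A = k\<close> by (intro divide_strict_right_mono) auto
  have increment: "\<bar>real (fst (step x c)) + r * weight (snd (step x c)) - r * weight x - r\<bar> \<le> 3"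
    if "x \<in> queues A" "c \<in> A" for x c
  proof -
    have "fst (step x c) \<le> 1"
      using step_legal[OF that] by (auto simp: legal_move_def)
    moreover have "0 \<le> r * weight y" "r * weight y \<le> 0.41025 * 2.8" for y :: "'a list"
      using mult_mono[of r "0.41025" "weight y" "2.8"] weight_bounds[of y] r by auto
    note this[of x] this[of "snd (step x c)"]
    ultimately show ?thesis using r by simp
  qed
  have "(\<lambda>n. measure_pmf.prob (random_word A n) {w. matches step [] w \<ge> \<rho> * n}) \<longlonglongrightarrow> 1"
  proof (rule matches_tendsto[where S = "queues A" and \<phi> = "\<lambda>x. r * weight x" and B = "r * 2.8"])
    show "card A * (r * weight x + r) \<le> (\<Sum>c\<in>A. real (fst (step x c)) + r * weight (snd (step x c)))"
      if "x \<in> queues A" for x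
      using step_drift[OF \<open>finite A\<close> _ that r_def] assms by simp
    show "r * weight x \<le> r * 2.8" for x :: "'a list"
      using weight_bounds r by (intro mult_left_mono) auto
    show "snd (step x c) \<in> queues A" if "x \<in> queues A" "c \<in> A" for x c
      using step_legal[OF that] by simp
    show "[] \<in> queues A" by (simp add: queues_def)
  qed (use \<open>finite A\<close> \<open>A \<noteq> {}\<close> \<open>\<rho> < r\<close> increment in simp_all)
  then show ?thesis
  proof (rule tendsto_sandwich[rotated 2, OF _ tendsto_const])
    show "\<forall>\<^sub>F n in sequentially. measure_pmf.prob (random_word A n) {w. matches step [] w \<ge> \<rho> * n}
        \<le> measure_pmf.prob (random_word A n)
            {w. real (max_twins w) \<ge> (1.64 * real k / (real k + 1)) * (real n / real k)}"
    proof (intro always_eventually allI)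
      fix n
      \<comment> \<open>The strategy is known to be legal only for letters of \<open>A\<close>, so
        the two events are compared on the support of the random word.\<close>
      have "set_pmf (random_word A n) = words A n"
        using assms \<open>A \<noteq> {}\<close> unfolding random_word_def
        by (simp add: finite_words words_nonempty)
      moreover have "matches step [] w \<le> max_twins w" if "w \<in> words A n" for w
      proof (rule matches_le_max_twins)
        show "set w \<subseteq> A" using that by (simp add: words_def)
        show "[] \<in> queues A" by (simp add: queues_def)
      qed (rule step_legal)
      moreover have "(1.64 * real k / (real k + 1)) * (real n / real k) = \<rho> * n"
        using assms by (simp add: \<rho>_def)
      ultimately show "measure_pmf.prob (random_word A n) {w. matches step [] w \<ge> \<rho> * n}
        \<le> measure_pmf.prob (random_word A n)
            {w. real (max_twins w) \<ge> (1.64 * real k / (real k + 1)) * (real n / real k)}"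
        by (intro measure_pmf.finite_measure_mono_AE) (auto simp: AE_measure_pmf_iff intro: order.trans)
    qed
  qed auto
qed

end
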